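(* Let $\psi(x,t)\ge0$ satisfy the linear problem $$\frac{\partial \psi}{\partial t} = D\frac{\partial^2\psi}{\partial x^2}+f'(0)\psi \quad\text{in } 0<x<L(t),\qquad \psi(0,t)=\psi(L(t),t)=0,$$ and assume that the following conditions hold: (i) $\dot L(t)L(t)$ is bounded below on $t\ge0$; (ii) $\displaystyle\int_0^T\left(\frac{D\pi^2}{L(t)^2}-\frac{D\pi^2}{L_{crit}^2}-\frac{L(t)[\ddot L(t)]^+}{4D}+\frac{\dot L(t)}{2L(t)}\right)dt\to\infty$ as $T\to\infty$. Then $\psi(x,t)$ converges uniformly (in $x$) to zero as $t\to\infty$.
   Context: Here $D>0$ and $f'(0)>0$ are constants (the reaction term is the linear function $f(\psi)=f'(0)\psi$), and $L_{crit}=\pi\sqrt{D/f'(0)}$. The function $L(t)$ is a prescribed twice continuously differentiable function of $t\ge0$ with $L(t)>0$ for all $t\ge0$; dots denote derivatives with respect to $t$. Solutions $\psi$ are non-negative, and the problem is posed for $t\ge0$. For any function $F(t)$, $[F(t)]^+\ge0$ and $[F(t)]^-\ge0$ denote its positive and negative parts, so that $F(t)\equiv[F(t)]^+-[F(t)]^-$. *)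

theory Defs
  imports "HOL-Analysis.Analysis"
begin

text \<open>Throughout, \<open>D\<close> is the diffusion coefficient and \<open>r\<close> stands for the constant \<open>f'(0)\<close>.\<close>

definition L_crit :: "real \<Rightarrow> real \<Rightarrow> real" where
  "L_crit D r = pi * sqrt (D / r)"

definition pos_part :: "real \<Rightarrow> real" where
  "pos_part y = max y 0"

text \<open>
  \<open>C2_halfline L L1 L2\<close>: on the half-line \<open>t \<ge> 0\<close> the function \<open>L\<close> is twice continuously
  differentiable with derivatives \<open>L1\<close> and \<open>L2\<close>, one-sided at \<open>t = 0\<close>; the values of
  the three functions at negative arguments are irrelevant.
\<close>

definition C2_halfline :: "(real \<Rightarrow> real) \<Rightarrow> (real \<Rightarrow> real) \<Rightarrow> (real \<Rightarrow> real) \<Rightarrow> bool" where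
  "C2_halfline L L1 L2 \<longleftrightarrow>
     (\<forall>t\<ge>0. (L has_real_derivative L1 t) (at t within {0..})) \<and>
     (\<forall>t\<ge>0. (L1 has_real_derivative L2 t) (at t within {0..})) \<and>
     continuous_on {0..} L2"

text \<open>
  Classical solutions \<open>\<psi> x t\<close> of \<open>\<psi>\<^sub>t = D \<psi>\<^sub>x\<^sub>x + r \<psi>\<close> in \<open>0 < x < L(t)\<close> with zero Dirichlet
  data on the moving boundary. The equation is required for \<open>t > 0\<close>, and \<open>\<psi>\<close> is jointly
  continuous up to the lateral boundary \<open>x = 0\<close>, \<open>x = L(t)\<close> for \<open>t > 0\<close>. Nothing is assumed
  on how the initial values are attained, so arbitrary initial data are allowed.
  The functions \<open>\<psi>t\<close>, \<open>\<psi>x\<close>, \<open>\<psi>xx\<close> are the partial derivatives; only their existence at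
  interior points is required, not their continuity.
\<close>

definition linear_moving_solution ::
    "real \<Rightarrow> real \<Rightarrow> (real \<Rightarrow> real) \<Rightarrow> (real \<Rightarrow> real \<Rightarrow> real) \<Rightarrow> bool" where
  "linear_moving_solution D r L \<psi> \<longleftrightarrow>
     continuous_on {(x, t). 0 < t \<and> 0 \<le> x \<and> x \<le> L t} (\<lambda>(x, t). \<psi> x t) \<and>
     (\<forall>t\<ge>0. \<psi> 0 t = 0 \<and> \<psi> (L t) t = 0) \<and>
     (\<exists>\<psi>t \<psi>x \<psi>xx. \<forall>t>0. \<forall>x. 0 < x \<and> x < L t \<longrightarrow>
        ((\<lambda>s. \<psi> x s) has_real_derivative \<psi>t x t) (at t) \<and>
        ((\<lambda>y. \<psi> y t) has_real_derivative \<psi>x x t) (at x) \<and>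
        ((\<lambda>y. \<psi>x y t) has_real_derivative \<psi>xx x t) (at x) \<and>
        \<psi>t x t = D * \<psi>xx x t + r * \<psi> x t)"

end

theory Submission imports Defs begin

text \<open>
  Write \<open>I(t)\<close> for the integral in the divergence condition. In the ansatz
  \<open>W = exp (- x\<^sup>2 L' / (4 D L) - I(t)) p(x / L, t)\<close> the drift due to the moving boundary cancels,
  and \<open>W\<close> is a supersolution as soon as \<open>p \<ge> 0\<close> and \<open>p\<^sub>t \<ge> (D / L\<^sup>2) (p\<^sub>\<xi>\<^sub>\<xi> + \<pi>\<^sup>2 p)\<close> on the
  fixed interval \<open>0 < \<xi> < 1\<close> (\<open>solution_le_barrier\<close>); \<open>p = C sin (\<pi> \<xi>)\<close> gives equality there.
  If such a barrier lies above the given solution at one time, it does so at all later times,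
  by the maximum principle. The exponent \<open>- x\<^sup>2 L' / (4 D L) = - (x / L)\<^sup>2 L L' / (4 D)\<close> is
  bounded above because \<open>L L'\<close> is bounded below, so the solution is at most a constant times
  \<open>exp (- I(t))\<close>, which tends to 0.

  To place a multiple of the eigenfunction above the solution at some time, one needs that the
  solution vanishes at least linearly at both ends; by assumption it is only continuous there. A second
  barrier, running from time 1 to time 2, provides this (\<open>dominated_by_eigenfunction\<close>). The
  change of variables is applied to the barriers only, never to the solution: the latter merely
  has partial derivatives, which do not suffice for a chain rule along \<open>x = \<xi> L(t)\<close>.
\<close>

section \<open>The weak maximum principle\<close>

lemma second_derivative_nonneg_at_local_min:
  fixes f f' :: "real \<Rightarrow> real"
  assumes "d > 0"
    and f': "\<And>y. \<bar>y - x\<bar> < d \<Longrightarrow> (f has_real_derivative f' y) (at y)"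
    and f'': "(f' has_real_derivative m) (at x)"
    and min: "\<And>y. \<bar>y - x\<bar> < d \<Longrightarrow> f x \<le> f y"
  shows "m \<ge> 0"
proof (rule ccontr)
  assume "\<not> m \<ge> 0"
  have crit: "f' x = 0"
  proof (rule DERIV_local_min[OF f' \<open>d > 0\<close>])
    show "\<bar>x - x\<bar> < d" using \<open>d > 0\<close> by simp
    show "\<forall>y. \<bar>x - y\<bar> < d \<longrightarrow> f x \<le> f y"
      using min by (simp add: abs_minus_commute)
  qed
  obtain e where "e > 0" and e: "\<And>h. 0 < h \<Longrightarrow> h < e \<Longrightarrow> f' (x + h) < f' x"
    using DERIV_neg_dec_right[OF f''] \<open>\<not> m \<ge> 0\<close> by (auto simp: not_le)
  define h where "h = min e d / 2"
  have h: "0 < h" "h < e" "h < d"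
    using \<open>e > 0\<close> \<open>d > 0\<close> by (auto simp: h_def min_def)
  obtain z where z: "x < z" "z < x + h" "f (x + h) - f x = (x + h - x) * f' z"
    using MVT2[of x "x + h" f f'] f' h by (smt (verit))
  have "f' z < 0"
    using e[of "z - x"] z h crit by simp
  then have "f (x + h) < f x"
    using z h mult_pos_neg[of h "f' z"] by simp
  then show False
    using min[of "x + h"] h by simp
qed

text \<open>
  The argument multiplies \<open>u\<close> by \<open>exp (-(r+1)t)\<close>, which makes the zeroth-order coefficient
  negative, and looks at a negative minimum over the compact space-time domain. Since the
  differential inequality is available up to the final time, the minimum may lie there, and
  only the left-hand time behaviour is used.
\<close>

lemma weak_minimum_principle:
  fixes D r T0 T1 :: real and L :: "real \<Rightarrow> real" and u ut ux uxx :: "real \<Rightarrow> real \<Rightarrow> real"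
  assumes "D > 0"
    and L_cont: "continuous_on {T0..T1} L"
    and u_cont: "continuous_on {(x, t). T0 \<le> t \<and> t \<le> T1 \<and> 0 \<le> x \<and> x \<le> L t} (\<lambda>(x, t). u x t)"
    and ut: "\<And>x t. T0 < t \<Longrightarrow> t \<le> T1 \<Longrightarrow> 0 < x \<Longrightarrow> x < L t \<Longrightarrow>
               ((\<lambda>s. u x s) has_real_derivative ut x t) (at t)"
    and ux: "\<And>x t. T0 < t \<Longrightarrow> t \<le> T1 \<Longrightarrow> 0 < x \<Longrightarrow> x < L t \<Longrightarrow>
               ((\<lambda>y. u y t) has_real_derivative ux x t) (at x)"
    and uxx: "\<And>x t. T0 < t \<Longrightarrow> t \<le> T1 \<Longrightarrow> 0 < x \<Longrightarrow> x < L t \<Longrightarrow>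
               ((\<lambda>y. ux y t) has_real_derivative uxx x t) (at x)"
    and super: "\<And>x t. T0 < t \<Longrightarrow> t \<le> T1 \<Longrightarrow> 0 < x \<Longrightarrow> x < L t \<Longrightarrow>
               ut x t \<ge> D * uxx x t + r * u x t"
    and initial: "\<And>x. 0 \<le> x \<Longrightarrow> x \<le> L T0 \<Longrightarrow> u x T0 \<ge> 0"
    and left: "\<And>t. T0 \<le> t \<Longrightarrow> t \<le> T1 \<Longrightarrow> u 0 t \<ge> 0"
    and right: "\<And>t. T0 \<le> t \<Longrightarrow> t \<le> T1 \<Longrightarrow> u (L t) t \<ge> 0"
    and pt: "T0 \<le> t" "t \<le> T1" "0 \<le> x" "x \<le> L t"
  shows "u x t \<ge> 0"
proof (rule ccontr)
  assume neg: "\<not> u x t \<ge> 0"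
  define Q where "Q = {(x, t). T0 \<le> t \<and> t \<le> T1 \<and> 0 \<le> x \<and> x \<le> L t}"
  define v where "v x t = exp (-(r + 1) * t) * u x t" for x t
  have "compact Q"
  proof -
    \<comment> \<open>The domain is the continuous image of a rectangle under \<open>(s, t) \<mapsto> (s L(t), t)\<close>,
       once the times with \<open>L(t) < 0\<close> have been discarded.\<close>
    define S where "S = {t \<in> {T0..T1}. 0 \<le> L t}"
    have "S = {T0..T1} \<inter> L -` {0..}" by (auto simp: S_def)
    then have "closed S"
      using continuous_closed_preimage[OF L_cont, of "{0..}"] by simp
    then have "compact S"
      using compact_Int_closed[of "{T0..T1}" S] by (simp add: S_def Int_absorb1 subset_iff)
    have "continuous_on ({0..1} \<times> S) (\<lambda>p. L (snd p))"
      by (rule continuous_on_compose2[OF L_cont]) (auto simp: S_def intro!: continuous_intros)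
    then have "compact ((\<lambda>(s, t). (s * L t, t)) ` ({0..1} \<times> S))"
      using \<open>compact S\<close>
      by (intro compact_continuous_image compact_Times)
         (auto simp: case_prod_unfold intro!: continuous_intros)
    also have "(\<lambda>(s, t). (s * L t, t)) ` ({0..1} \<times> S) = Q"
    proof (intro equalityI subsetI)
      fix p assume "p \<in> Q"
      then obtain x t where p: "p = (x, t)" "T0 \<le> t" "t \<le> T1" "0 \<le> x" "x \<le> L t"
        by (auto simp: Q_def)
      show "p \<in> (\<lambda>(s, t). (s * L t, t)) ` ({0..1} \<times> S)"
        using p by (intro image_eqI[of _ _ "(x / L t, t)"])
          (auto simp: S_def divide_simps)
    qed (auto simp: Q_def S_def mult_left_le_one_le)
    finally show ?thesis .
  qed
  moreover have "continuous_on Q (\<lambda>(x, t). v x t)"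
    using u_cont unfolding v_def Q_def case_prod_unfold by (intro continuous_intros)
  moreover have "(x, t) \<in> Q" using pt by (simp add: Q_def)
  ultimately obtain p where "p \<in> Q" and p: "\<And>q. q \<in> Q \<Longrightarrow> (case p of (x, t) \<Rightarrow> v x t) \<le> (case q of (x, t) \<Rightarrow> v x t)"
    using continuous_attains_inf[of Q "\<lambda>(x, t). v x t"] by blast
  then obtain y s where ys: "(y, s) \<in> Q" and min: "\<And>x t. (x, t) \<in> Q \<Longrightarrow> v y s \<le> v x t"
    by (cases p) fastforce
  have "v y s < 0"
    using min[OF \<open>(x, t) \<in> Q\<close>] neg by (simp add: v_def mult_pos_neg not_le le_less_trans)
  then have u_neg: "u y s < 0"
    by (simp add: v_def mult_less_0_iff)
  then have s: "T0 < s" "s \<le> T1" and y: "0 < y" "y < L s"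
    using ys initial[of y] left[of s] right[of s] unfolding Q_def
    by (auto simp: order.order_iff_strict)
  let ?E = "\<lambda>t. exp (-(r + 1) * t)"
  have "?E s * uxx y s \<ge> 0"
  proof (rule second_derivative_nonneg_at_local_min)
    show "min y (L s - y) > 0" using y by simp
    fix z assume "\<bar>z - y\<bar> < min y (L s - y)"
    then have z: "0 < z" "z < L s" by auto
    show "((\<lambda>z. v z s) has_real_derivative ?E s * ux z s) (at z)"
      unfolding v_def by (rule DERIV_cmult[OF ux[OF s z]])
    show "v y s \<le> v z s" using min s z by (simp add: Q_def)
  next
    show "((\<lambda>z. ?E s * ux z s) has_real_derivative ?E s * uxx y s) (at y)"
      by (rule DERIV_cmult[OF uxx[OF s y]])
  qed
  then have "uxx y s \<ge> 0"
    by (simp add: zero_le_mult_iff)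
  then have "D * uxx y s \<ge> 0"
    using \<open>D > 0\<close> by simp
  then have "ut y s - (r + 1) * u y s > 0"
    using super[OF s y] u_neg by (simp add: algebra_simps)
  then have pos: "?E s * (ut y s - (r + 1) * u y s) > 0"
    by simp
  have "((\<lambda>t. v y t) has_real_derivative ?E s * (ut y s - (r + 1) * u y s)) (at s)"
    unfolding v_def by (auto intro!: derivative_eq_intros ut[OF s y] simp: algebra_simps)
  from DERIV_pos_inc_left[OF this pos] obtain d
    where "d > 0" and d: "\<And>h. 0 < h \<Longrightarrow> h < d \<Longrightarrow> v y (s - h) < v y s" by blast
  obtain e where "e > 0" and e: "\<And>t. t \<in> {T0..T1} \<Longrightarrow> dist t s < e \<Longrightarrow> dist (L t) (L s) < L s - y"
    using L_cont s y unfolding continuous_on_iff by (metis atLeastAtMost_iff diff_gt_0_iff_gt less_imp_le)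
  define h where "h = min (min d e) (s - T0) / 2"
  have h: "0 < h" "h < d" "h < e" "h < s - T0"
    using \<open>d > 0\<close> \<open>e > 0\<close> s by (auto simp: h_def min_def)
  have "(y, s - h) \<in> Q"
    using e[of "s - h"] h s y by (auto simp: Q_def dist_real_def)
  then show False
    using min d h by (smt (verit))
qed

section \<open>Barriers on the moving interval\<close>

locale moving_interval =
  fixes D r :: real and L L1 L2 :: "real \<Rightarrow> real"
  assumes D_pos: "D > 0" and r_pos: "r > 0"
    and C2: "C2_halfline L L1 L2"
    and L_pos: "\<And>t. t \<ge> 0 \<Longrightarrow> L t > 0"
begin

text \<open>The integrand of the divergence condition, and its primitive.\<close>

definition rate :: "real \<Rightarrow> real" where
  "rate t = D * pi\<^sup>2 / (L t)\<^sup>2 - D * pi\<^sup>2 / (L_crit D r)\<^sup>2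
              - L t * pos_part (L2 t) / (4 * D) + L1 t / (2 * L t)"

definition gain :: "real \<Rightarrow> real" where
  "gain T = integral {0..T} rate"

text \<open>
  The exponential weight that removes the drift caused by the moving boundary, and the barrier
  built from it with profile \<open>a(t) q(x / L(t)) + b(t)\<close>.
\<close>

definition weight :: "real \<Rightarrow> real \<Rightarrow> real" where
  "weight x t = exp (- (x\<^sup>2 * L1 t / (4 * D * L t)) - gain t)"

definition barrier :: "(real \<Rightarrow> real) \<Rightarrow> (real \<Rightarrow> real) \<Rightarrow> (real \<Rightarrow> real) \<Rightarrow> real \<Rightarrow> real \<Rightarrow> real" where
  "barrier a b q x t = weight x t * (a t * q (x / L t) + b t)"

lemma continuous_L: "continuous_on {0..} L"
  and continuous_L1: "continuous_on {0..} L1"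
  and continuous_L2: "continuous_on {0..} L2"
  using C2 unfolding C2_halfline_def
  by (auto intro: DERIV_continuous_on[of _ L L1] DERIV_continuous_on[of _ L1 L2])

lemma has_derivative_L: "t > 0 \<Longrightarrow> (L has_real_derivative L1 t) (at t)"
  and has_derivative_L1: "t > 0 \<Longrightarrow> (L1 has_real_derivative L2 t) (at t)"
proof -
  assume "t > 0"
  then have "at t within {0..} = at t"
    by (intro at_within_interior) simp
  then show "(L has_real_derivative L1 t) (at t)" "(L1 has_real_derivative L2 t) (at t)"
    using C2 \<open>t > 0\<close> unfolding C2_halfline_def by (metis less_imp_le)+
qed

lemma reaction_eq: "D * pi\<^sup>2 / (L_crit D r)\<^sup>2 = r"
  using D_pos r_pos by (simp add: L_crit_def power_mult_distrib)

lemma continuous_rate: "continuous_on {0..} rate"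
proof -
  have "L t \<noteq> 0" if "t \<in> {0..}" for t
    using L_pos[of t] that by simp
  then show ?thesis
    unfolding rate_def reaction_eq pos_part_def using D_pos
    by (intro continuous_intros continuous_L continuous_L1 continuous_L2) simp_all
qed

lemma has_derivative_gain:
  assumes "t > 0"
  shows "(gain has_real_derivative rate t) (at t)"
proof -
  have "((\<lambda>x. integral {0..x} rate) has_real_derivative rate t) (at t within {0..t + 1})"
    using assms by (intro integral_has_real_derivative continuous_on_subset[OF continuous_rate]) auto
  moreover have "at t within {0..t + 1} = at t"
    using assms by (intro at_within_interior) simp
  ultimately show ?thesis
    by (simp add: gain_def[abs_def])
qed

lemma continuous_gain: "continuous_on {0<..} gain"
  by (intro continuous_at_imp_continuous_on ballI DERIV_isCont[OF has_derivative_gain]) simp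

lemma weight_pos: "weight x t > 0"
  by (simp add: weight_def)

lemma has_derivative_weight_x:
  assumes "t > 0"
  shows "((\<lambda>x. weight x t) has_real_derivative - (x * L1 t / (2 * D * L t)) * weight x t) (at x)"
proof -
  have "((\<lambda>x. - (x\<^sup>2 * L1 t / (4 * D * L t)) - gain t) has_real_derivative
          - (x * L1 t / (2 * D * L t))) (at x)"
    using D_pos L_pos[of t] assms by (auto intro!: derivative_eq_intros)
  from DERIV_fun_exp[OF this] show ?thesis
    unfolding weight_def by (simp add: mult.commute[of "exp _"])
qed

lemma has_derivative_weight_t:
  assumes "t > 0"
  shows "((\<lambda>t. weight x t) has_real_derivative
           (- (x\<^sup>2 / (4 * D)) * (L2 t / L t - (L1 t)\<^sup>2 / (L t)\<^sup>2) - rate t) * weight x t) (at t)"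
proof -
  have L: "L t > 0" using L_pos assms by simp
  have "((\<lambda>t. L1 t / L t) has_real_derivative (L2 t * L t - L1 t * L1 t) / (L t * L t)) (at t)"
    using L assms by (intro DERIV_divide has_derivative_L has_derivative_L1) auto
  also have "(L2 t * L t - L1 t * L1 t) / (L t * L t) = L2 t / L t - (L1 t)\<^sup>2 / (L t)\<^sup>2"
    using L by (simp add: diff_divide_distrib power2_eq_square)
  finally have "((\<lambda>t. - (x\<^sup>2 / (4 * D)) * (L1 t / L t) - gain t) has_real_derivative
      - (x\<^sup>2 / (4 * D)) * (L2 t / L t - (L1 t)\<^sup>2 / (L t)\<^sup>2) - rate t) (at t)"
    using assms by (intro DERIV_diff DERIV_cmult has_derivative_gain)
  from DERIV_fun_exp[OF this] show ?thesis
    unfolding weight_def by (simp add: mult.commute[of "exp _"])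
qed

text \<open>
  The comparison holds because the barrier is a supersolution as soon as its profile is one for
  \<open>p\<^sub>t = (D / L\<^sup>2) (p\<^sub>\<xi>\<^sub>\<xi> + \<pi>\<^sup>2 p)\<close> on the fixed interval \<open>0 < \<xi> < 1\<close>: the weight cancels the
  first-order term, and \<open>- x\<^sup>2 L'' / (4 D L)\<close>, the part of the zeroth-order coefficient that
  depends on \<open>x\<close>, is at least the quantity \<open>- L [L'']\<^sup>+ / (4 D)\<close> that enters \<open>rate\<close>.
\<close>

lemma solution_le_barrier:
  assumes t: "T0 > 0" "T0 \<le> t" "t \<le> T1" and x: "0 \<le> x" "x \<le> L t"
    and sol: "linear_moving_solution D r L \<psi>"
    and a': "\<And>t. T0 < t \<Longrightarrow> t \<le> T1 \<Longrightarrow> (a has_real_derivative a' t) (at t)"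
    and b': "\<And>t. T0 < t \<Longrightarrow> t \<le> T1 \<Longrightarrow> (b has_real_derivative b' t) (at t)"
    and q': "\<And>\<xi>. (q has_real_derivative q' \<xi>) (at \<xi>)"
    and q'': "\<And>\<xi>. (q' has_real_derivative q'' \<xi>) (at \<xi>)"
    and cont: "continuous_on {T0..T1} a" "continuous_on {T0..T1} b"
    and nonneg: "\<And>\<xi> t. 0 \<le> \<xi> \<Longrightarrow> \<xi> \<le> 1 \<Longrightarrow> T0 \<le> t \<Longrightarrow> t \<le> T1 \<Longrightarrow> a t * q \<xi> + b t \<ge> 0"
    and super: "\<And>\<xi> t. 0 < \<xi> \<Longrightarrow> \<xi> < 1 \<Longrightarrow> T0 < t \<Longrightarrow> t \<le> T1 \<Longrightarrow>
                  a' t * q \<xi> + b' t \<ge> D / (L t)\<^sup>2 * (a t * q'' \<xi> + pi\<^sup>2 * (a t * q \<xi> + b t))"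
    and initial: "\<And>x. 0 \<le> x \<Longrightarrow> x \<le> L T0 \<Longrightarrow> \<psi> x T0 \<le> barrier a b q x T0"
  shows "\<psi> x t \<le> barrier a b q x t"
proof -
  obtain \<psi>t \<psi>x \<psi>xx where \<psi>:
    "\<And>x t. 0 < t \<Longrightarrow> 0 < x \<Longrightarrow> x < L t \<Longrightarrow> ((\<lambda>s. \<psi> x s) has_real_derivative \<psi>t x t) (at t)"
    "\<And>x t. 0 < t \<Longrightarrow> 0 < x \<Longrightarrow> x < L t \<Longrightarrow> ((\<lambda>y. \<psi> y t) has_real_derivative \<psi>x x t) (at x)"
    "\<And>x t. 0 < t \<Longrightarrow> 0 < x \<Longrightarrow> x < L t \<Longrightarrow> ((\<lambda>y. \<psi>x y t) has_real_derivative \<psi>xx x t) (at x)"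
    "\<And>x t. 0 < t \<Longrightarrow> 0 < x \<Longrightarrow> x < L t \<Longrightarrow> \<psi>t x t = D * \<psi>xx x t + r * \<psi> x t"
    using sol unfolding linear_moving_solution_def by blast
  have \<psi>_cont: "continuous_on {(x, t). 0 < t \<and> 0 \<le> x \<and> x \<le> L t} (\<lambda>(x, t). \<psi> x t)"
    and \<psi>_bdry: "\<And>t. t \<ge> 0 \<Longrightarrow> \<psi> 0 t = 0 \<and> \<psi> (L t) t = 0"
    using sol unfolding linear_moving_solution_def by auto
  let ?p = "\<lambda>x t. a t * q (x / L t) + b t"
  let ?k = "\<lambda>x t. x * L1 t / (2 * D * L t)"
  \<comment> \<open>The partial derivatives of the barrier, with the weight factored out.\<close>
  define Wt where "Wt x t = weight x t *
      (a' t * q (x / L t) + b' t - a t * q' (x / L t) * x * L1 t / (L t)\<^sup>2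
        + (- (x\<^sup>2 / (4 * D)) * (L2 t / L t - (L1 t)\<^sup>2 / (L t)\<^sup>2) - rate t) * ?p x t)" for x t
  define Wx where "Wx x t = weight x t * (a t * q' (x / L t) / L t - ?k x t * ?p x t)" for x t
  define Wxx where "Wxx x t = weight x t *
      (a t * q'' (x / L t) / (L t)\<^sup>2 - 2 * ?k x t * (a t * q' (x / L t) / L t)
        - L1 t / (2 * D * L t) * ?p x t + (?k x t)\<^sup>2 * ?p x t)" for x t
  have "barrier a b q x t - \<psi> x t \<ge> 0"
  proof (rule weak_minimum_principle[where u = "\<lambda>x t. barrier a b q x t - \<psi> x t"
        and ut = "\<lambda>x t. Wt x t - \<psi>t x t" and ux = "\<lambda>x t. Wx x t - \<psi>x x t"
        and uxx = "\<lambda>x t. Wxx x t - \<psi>xx x t", OF D_pos])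
    show "continuous_on {T0..T1} L"
      using t by (intro continuous_on_subset[OF continuous_L]) auto
    let ?Q = "{(x, t). T0 \<le> t \<and> t \<le> T1 \<and> 0 \<le> x \<and> x \<le> L t}"
    have time: "continuous_on ?Q (\<lambda>p. f (snd p))" if "continuous_on {T0..T1} f" for f :: "real \<Rightarrow> real"
      by (rule continuous_on_compose2[OF that]) (auto intro!: continuous_intros)
    have space: "continuous_on ?Q (\<lambda>p. q (f p))" if "continuous_on ?Q f" for f :: "real \<times> real \<Rightarrow> real"
      by (rule continuous_on_compose2[OF _ that, of UNIV])
         (auto intro!: continuous_at_imp_continuous_on DERIV_isCont[OF q'])
    have "continuous_on {T0..T1} L" "continuous_on {T0..T1} L1" "continuous_on {T0..T1} gain"
      using t by (auto intro: continuous_on_subset[OF continuous_L] continuous_on_subset[OF continuous_L1]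
          continuous_on_subset[OF continuous_gain])
    then have "continuous_on ?Q (\<lambda>p. barrier a b q (fst p) (snd p))"
      unfolding barrier_def weight_def using D_pos t L_pos
      by (intro continuous_intros time space cont) (auto simp: less_le)
    moreover have "continuous_on ?Q (\<lambda>(x, t). \<psi> x t)"
      using t by (intro continuous_on_subset[OF \<psi>_cont]) auto
    ultimately show "continuous_on ?Q (\<lambda>(x, t). barrier a b q x t - \<psi> x t)"
      by (auto simp: case_prod_unfold intro: continuous_on_diff)
  next
    fix x t assume *: "T0 < t" "t \<le> T1" "0 < x" "x < L t"
    have "t > 0" using * t by simp
    have L: "L t > 0" using L_pos \<open>t > 0\<close> by simp
    have "((\<lambda>t. x / L t) has_real_derivative - (x * L1 t / (L t)\<^sup>2)) (at t)"
      by (rule derivative_eq_intros has_derivative_L \<open>t > 0\<close> refl)+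
         (use L in \<open>simp_all add: field_simps power2_eq_square\<close>)
    from DERIV_chain2[OF q' this]
    have "((\<lambda>t. barrier a b q x t) has_real_derivative
        (- (x\<^sup>2 / (4 * D)) * (L2 t / L t - (L1 t)\<^sup>2 / (L t)\<^sup>2) - rate t) * weight x t * ?p x t
        + (a' t * q (x / L t) + q' (x / L t) * - (x * L1 t / (L t)\<^sup>2) * a t + b' t) * weight x t) (at t)"
      unfolding barrier_def
      by (intro DERIV_mult DERIV_add has_derivative_weight_t a' b' * \<open>t > 0\<close>)
    then have "((\<lambda>t. barrier a b q x t) has_real_derivative Wt x t) (at t)"
      unfolding Wt_def by (rule DERIV_cong) (simp add: algebra_simps)
    then show "((\<lambda>t. barrier a b q x t - \<psi> x t) has_real_derivative Wt x t - \<psi>t x t) (at t)"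
      using \<psi>(1)[OF \<open>t > 0\<close>] * by (intro DERIV_diff) auto
    have div: "((\<lambda>x. x / L t) has_real_derivative 1 / L t) (at x)"
      by (intro DERIV_cdivide DERIV_ident)
    have px: "((\<lambda>x. ?p x t) has_real_derivative a t * (q' (x / L t) * (1 / L t)) + 0) (at x)"
      by (intro DERIV_add DERIV_cmult DERIV_chain2[OF q' div] DERIV_const)
    have kx: "((\<lambda>x. ?k x t) has_real_derivative L1 t / (2 * D * L t)) (at x)"
      using L D_pos by (auto intro!: derivative_eq_intros)
    have "((\<lambda>x. barrier a b q x t) has_real_derivative Wx x t) (at x)"
      unfolding barrier_def Wx_def
      by (rule DERIV_cong[OF DERIV_mult[OF has_derivative_weight_x[OF \<open>t > 0\<close>] px]])
         (simp add: algebra_simps)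
    then show "((\<lambda>x. barrier a b q x t - \<psi> x t) has_real_derivative Wx x t - \<psi>x x t) (at x)"
      using \<psi>(2)[OF \<open>t > 0\<close>] * by (intro DERIV_diff) auto
    have "((\<lambda>x. Wx x t) has_real_derivative Wxx x t) (at x)"
      unfolding Wx_def Wxx_def
      by (rule DERIV_cong[OF DERIV_mult[OF has_derivative_weight_x[OF \<open>t > 0\<close>]
              DERIV_diff[OF DERIV_cdivide[OF DERIV_cmult[OF DERIV_chain2[OF q'' div]]]
                DERIV_mult[OF kx px]]]])
         (simp add: algebra_simps power2_eq_square)
    then show "((\<lambda>x. Wx x t - \<psi>x x t) has_real_derivative Wxx x t - \<psi>xx x t) (at x)"
      using \<psi>(3)[OF \<open>t > 0\<close>] * by (intro DERIV_diff) auto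
    define P where "P = ?p x t"
    have "P \<ge> 0" unfolding P_def using * L by (intro nonneg) auto
    have "x\<^sup>2 * L2 t \<le> x\<^sup>2 * pos_part (L2 t)"
      by (intro mult_left_mono) (auto simp: pos_part_def)
    also have "\<dots> \<le> (L t)\<^sup>2 * pos_part (L2 t)"
      using * by (intro mult_right_mono power_mono) (auto simp: pos_part_def)
    finally have "x\<^sup>2 * L2 t / (4 * D * L t) \<le> (L t)\<^sup>2 * pos_part (L2 t) / (4 * D * L t)"
      using D_pos L by (intro divide_right_mono) auto
    also have "\<dots> = L t * pos_part (L2 t) / (4 * D)"
      using L by (simp add: power2_eq_square)
    finally have "- (D * pi\<^sup>2 / (L t)\<^sup>2) * P
        \<le> (L1 t / (2 * L t) - x\<^sup>2 * L2 t / (4 * D * L t) - rate t - r) * P"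
      using \<open>P \<ge> 0\<close> unfolding rate_def reaction_eq by (intro mult_right_mono) simp_all
    moreover have "D / (L t)\<^sup>2 * (a t * q'' (x / L t) + pi\<^sup>2 * P) \<le> a' t * q (x / L t) + b' t"
      unfolding P_def using * L by (intro super) auto
    ultimately have "0 \<le> a' t * q (x / L t) + b' t - D * a t * q'' (x / L t) / (L t)\<^sup>2
        + (L1 t / (2 * L t) - x\<^sup>2 * L2 t / (4 * D * L t) - rate t - r) * P"
      by (simp add: algebra_simps)
    then have "0 \<le> weight x t * \<dots>"
      using weight_pos[of x t] by simp
    also have "\<dots> = Wt x t - D * Wxx x t - r * barrier a b q x t"
    proof -
      have drift: "D * (2 * ?k x t * (a t * q' (x / L t) / L t)) = a t * q' (x / L t) * x * L1 t / (L t)\<^sup>2"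
        and const: "D * (L1 t / (2 * D * L t) * P) = L1 t / (2 * L t) * P"
        and square: "D * ((?k x t)\<^sup>2 * P) = x\<^sup>2 * (L1 t)\<^sup>2 / (4 * D * (L t)\<^sup>2) * P"
        and potential: "x\<^sup>2 / (4 * D) * (L2 t / L t - (L1 t)\<^sup>2 / (L t)\<^sup>2)
          = x\<^sup>2 * L2 t / (4 * D * L t) - x\<^sup>2 * (L1 t)\<^sup>2 / (4 * D * (L t)\<^sup>2)"
        and diffusion: "D * (a t * q'' (x / L t) / (L t)\<^sup>2) = D * a t * q'' (x / L t) / (L t)\<^sup>2"
        using L D_pos by (simp_all add: power2_eq_square right_diff_distrib mult_ac)
      have "a' t * q (x / L t) + b' t - D * a t * q'' (x / L t) / (L t)\<^sup>2
          + (L1 t / (2 * L t) - x\<^sup>2 * L2 t / (4 * D * L t) - rate t - r) * P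
        = (a' t * q (x / L t) + b' t - a t * q' (x / L t) * x * L1 t / (L t)\<^sup>2
            + (- (x\<^sup>2 / (4 * D)) * (L2 t / L t - (L1 t)\<^sup>2 / (L t)\<^sup>2) - rate t) * P)
          - D * (a t * q'' (x / L t) / (L t)\<^sup>2 - 2 * ?k x t * (a t * q' (x / L t) / L t)
              - L1 t / (2 * D * L t) * P + (?k x t)\<^sup>2 * P) - r * P"
        unfolding distrib_left[of D] right_diff_distrib[of D] drift const square diffusion
          mult_minus_left potential
        by (simp only: left_diff_distrib minus_diff_eq)
      then show ?thesis
        unfolding Wt_def Wxx_def barrier_def P_def[symmetric]
        by (simp only: right_diff_distrib[of "weight x t"] mult.left_commute[of _ "weight x t"])
    qed
    finally show "D * (Wxx x t - \<psi>xx x t) + r * (barrier a b q x t - \<psi> x t) \<le> Wt x t - \<psi>t x t"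
      using \<psi>(4)[OF \<open>t > 0\<close> *(3,4)] by (simp add: algebra_simps)
  next
    fix t assume *: "T0 \<le> t" "t \<le> T1"
    then have L: "L t > 0" using L_pos t by simp
    have "barrier a b q x t \<ge> 0" if "0 \<le> x" "x \<le> L t" for x
      unfolding barrier_def using that L * weight_pos[of x t]
      by (intro mult_nonneg_nonneg nonneg) auto
    then show "barrier a b q 0 t - \<psi> 0 t \<ge> 0" "barrier a b q (L t) t - \<psi> (L t) t \<ge> 0"
      using \<psi>_bdry[of t] * t L by auto
  qed (use t x initial in auto)
  then show ?thesis by simp
qed

section \<open>Linear vanishing at the ends\<close>

text \<open>
  A barrier on the time interval from 1 to 2 replaces a boundary point lemma: whatever
  the values at time 1, at time 2 the solution is dominated by a multiple of the weighted
  principal eigenfunction. With \<open>s = sin (\<pi> \<xi>)\<close>, the profile \<open>q = s - s\<^sup>2 / 4\<close> satisfies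
  \<open>0 \<le> q \<le> s\<close> and \<open>q'' \<le> - \<pi>\<^sup>2 / 2\<close> up to the boundary. This strict concavity pays for the decrease
  of the spatially constant part \<open>b\<close> from a bound on the initial values down to zero.
\<close>

lemma dominated_by_eigenfunction:
  assumes sol: "linear_moving_solution D r L \<psi>"
  obtains C where "C \<ge> 0"
    "\<And>x. 0 \<le> x \<Longrightarrow> x \<le> L 2 \<Longrightarrow> \<psi> x 2 \<le> weight x 2 * (C * sin (pi * (x / L 2)))"
proof -
  have "continuous_on {0..L 1} ((\<lambda>(x, t). \<psi> x t) \<circ> (\<lambda>x. (x, 1)))"
    using sol unfolding linear_moving_solution_def
    by (intro continuous_on_compose continuous_intros continuous_on_subset[where t = "(\<lambda>x. (x, 1)) ` {0..L 1}"])
       (auto elim: continuous_on_subset)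
  then have "continuous_on {0..L 1} (\<lambda>x. \<psi> x 1 / weight x 1)"
    unfolding weight_def using D_pos L_pos[of 1]
    by (intro continuous_intros) (simp_all add: o_def)
  then have "bdd_above ((\<lambda>x. \<psi> x 1 / weight x 1) ` {0..L 1})"
    by (intro bounded_imp_bdd_above compact_imp_bounded compact_continuous_image) auto
  then obtain N0 where N0: "\<And>x. 0 \<le> x \<Longrightarrow> x \<le> L 1 \<Longrightarrow> \<psi> x 1 / weight x 1 \<le> N0"
    by (fastforce simp: bdd_above_def)
  define N where "N = max N0 0"
  have "N \<ge> 0" by (simp add: N_def)
  have N: "\<psi> x 1 \<le> weight x 1 * N" if "0 \<le> x" "x \<le> L 1" for x
  proof -
    have "\<psi> x 1 / weight x 1 \<le> N" using N0[OF that] by (simp add: N_def)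
    then show ?thesis using weight_pos[of x 1] by (simp add: divide_le_eq mult.commute)
  qed
  have L12: "continuous_on {1..2} L"
    by (rule continuous_on_subset[OF continuous_L]) auto
  obtain tmax where tmax: "tmax \<in> {1..2}" "\<And>t. t \<in> {1..2} \<Longrightarrow> L t \<le> L tmax"
    using continuous_attains_sup[OF _ _ L12] by auto
  obtain tmin where tmin: "tmin \<in> {1..2}" "\<And>t. t \<in> {1..2} \<Longrightarrow> L tmin \<le> L t"
    using continuous_attains_inf[OF _ _ L12] by auto
  have Lmin: "L tmin > 0" and Lmax: "L tmax > 0"
    using L_pos tmin(1) tmax(1) by auto
  \<comment> \<open>The growth rate \<open>\<mu>\<close> absorbs the zeroth-order term \<open>(D \<pi>\<^sup>2 / L\<^sup>2) p\<close>, and \<open>k\<close> is so large that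
     the diffusion term \<open>- (D / L\<^sup>2) k \<pi>\<^sup>2 / 2\<close> outweighs the decrease of \<open>b\<close> at rate \<open>N\<close>.\<close>
  define \<mu> where "\<mu> = D * pi\<^sup>2 / (L tmin)\<^sup>2"
  define k where "k = 2 * N * (L tmax)\<^sup>2 / (D * pi\<^sup>2)"
  have "\<mu> \<ge> 0" "k \<ge> 0" using D_pos \<open>N \<ge> 0\<close> by (simp_all add: \<mu>_def k_def)
  define a where "a t = k * exp (\<mu> * t)" for t
  define b where "b t = N * (2 - t) * exp (\<mu> * t)" for t
  define q where "q \<xi> = sin (pi * \<xi>) - (sin (pi * \<xi>))\<^sup>2 / 4" for \<xi>
  define q' where "q' \<xi> = pi * cos (pi * \<xi>) * (1 - sin (pi * \<xi>) / 2)" for \<xi>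
  define q'' where "q'' \<xi> = pi\<^sup>2 * ((sin (pi * \<xi>))\<^sup>2 - sin (pi * \<xi>) - 1 / 2)" for \<xi>
  have sin01: "0 \<le> sin (pi * \<xi>)" if "0 \<le> \<xi>" "\<xi> \<le> 1" for \<xi> :: real
    using that by (intro sin_ge_zero) (auto simp: mult_left_le)
  have sq: "(sin (pi * \<xi>))\<^sup>2 \<le> sin (pi * \<xi>)" if "0 \<le> \<xi>" "\<xi> \<le> 1" for \<xi> :: real
    using sin01[OF that] by (simp add: power2_eq_square mult_left_le)
  have q: "0 \<le> q \<xi>" "q \<xi> \<le> sin (pi * \<xi>)" "q'' \<xi> \<le> - pi\<^sup>2 / 2" if "0 \<le> \<xi>" "\<xi> \<le> 1" for \<xi>
  proof -
    show "0 \<le> q \<xi>" "q \<xi> \<le> sin (pi * \<xi>)"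
      using sin01[OF that] sq[OF that] by (simp_all add: q_def)
    have "q'' \<xi> \<le> pi\<^sup>2 * (- 1 / 2)"
      unfolding q''_def using sq[OF that] by (intro mult_left_mono) auto
    then show "q'' \<xi> \<le> - pi\<^sup>2 / 2" by simp
  qed
  have bound: "\<psi> x 2 \<le> barrier a b q x 2" if x: "0 \<le> x" "x \<le> L 2" for x
  proof (rule solution_le_barrier[where ?T0.0 = 1 and ?T1.0 = 2 and q' = q' and q'' = q''
        and a' = "\<lambda>t. \<mu> * a t" and b' = "\<lambda>t. \<mu> * b t - N * exp (\<mu> * t)"])
    show "(a has_real_derivative \<mu> * a t) (at t)" for t
      unfolding a_def by (auto intro!: derivative_eq_intros)
    show "(b has_real_derivative \<mu> * b t - N * exp (\<mu> * t)) (at t)" for t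
      unfolding b_def by (auto intro!: derivative_eq_intros simp: algebra_simps)
    show "(q has_real_derivative q' \<xi>) (at \<xi>)" for \<xi>
      unfolding q_def q'_def by (auto intro!: derivative_eq_intros simp: algebra_simps)
    have "(q' has_real_derivative
        pi * (- sin (pi * \<xi>) * pi) * (1 - sin (pi * \<xi>) / 2) - pi * cos (pi * \<xi>) * (cos (pi * \<xi>) * pi / 2)) (at \<xi>)" for \<xi>
      unfolding q'_def by (auto intro!: derivative_eq_intros)
    moreover have "pi * (- sin (pi * \<xi>) * pi) * (1 - sin (pi * \<xi>) / 2)
        - pi * cos (pi * \<xi>) * (cos (pi * \<xi>) * pi / 2) = q'' \<xi>" for \<xi>
    proof -
      have "pi * cos (pi * \<xi>) * (cos (pi * \<xi>) * pi / 2) = pi\<^sup>2 * (cos (pi * \<xi>))\<^sup>2 / 2"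
        by (simp add: power2_eq_square)
      then show ?thesis
        unfolding q''_def cos_squared_eq by (simp add: algebra_simps power2_eq_square)
    qed
    ultimately show "(q' has_real_derivative q'' \<xi>) (at \<xi>)" for \<xi> by simp
    show "continuous_on {1..2} a" "continuous_on {1..2} b"
      unfolding a_def b_def by (intro continuous_intros)+
    show nonneg: "a t * q \<xi> + b t \<ge> 0" if "0 \<le> \<xi>" "\<xi> \<le> 1" "1 \<le> t" "t \<le> 2" for \<xi> t
      using q(1)[OF that(1,2)] that \<open>N \<ge> 0\<close> \<open>k \<ge> 0\<close> by (simp add: a_def b_def)
    show "\<psi> x 1 \<le> barrier a b q x 1" if "0 \<le> x" "x \<le> L 1" for x
    proof -
      have "N * 1 \<le> N * exp \<mu>" using \<open>N \<ge> 0\<close> \<open>\<mu> \<ge> 0\<close> by (intro mult_left_mono) auto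
      also have "\<dots> \<le> a 1 * q (x / L 1) + b 1"
        using q(1)[of "x / L 1"] that L_pos[of 1] \<open>k \<ge> 0\<close> by (simp add: a_def b_def)
      finally show ?thesis
        using N[OF that] weight_pos[of x 1] unfolding barrier_def
        by (smt (verit) mult_left_mono)
    qed
    fix \<xi> t :: real assume *: "0 < \<xi>" "\<xi> < 1" "1 < t" "t \<le> 2"
    have L: "L t > 0" "L tmin \<le> L t" "L t \<le> L tmax" using * L_pos tmin tmax by auto
    have "D / (L t)\<^sup>2 * (pi\<^sup>2 * (a t * q \<xi> + b t)) = D * pi\<^sup>2 / (L t)\<^sup>2 * (a t * q \<xi> + b t)"
      by simp
    also have "\<dots> \<le> \<mu> * (a t * q \<xi> + b t)"
      unfolding \<mu>_def using * L Lmin D_pos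
      by (intro mult_right_mono nonneg divide_left_mono power_mono) auto
    finally have "D / (L t)\<^sup>2 * (pi\<^sup>2 * (a t * q \<xi> + b t)) \<le> \<mu> * (a t * q \<xi> + b t)" .
    moreover have "D / (L t)\<^sup>2 * (a t * q'' \<xi>) \<le> - N * exp (\<mu> * t)"
    proof -
      have "a t * q'' \<xi> \<le> a t * (- pi\<^sup>2 / 2)"
        using q(3)[of \<xi>] * \<open>k \<ge> 0\<close> by (intro mult_left_mono) (auto simp: a_def)
      then have "D / (L t)\<^sup>2 * (a t * q'' \<xi>) \<le> D / (L t)\<^sup>2 * (a t * (- pi\<^sup>2 / 2))"
        using D_pos by (intro mult_left_mono[where c = "D / (L t)\<^sup>2"]) simp_all
      also have "\<dots> = - (N * exp (\<mu> * t) * ((L tmax)\<^sup>2 / (L t)\<^sup>2))"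
        unfolding a_def k_def using D_pos L Lmax by (simp add: field_simps)
      also have "\<dots> \<le> - (N * exp (\<mu> * t) * 1)"
        using L \<open>N \<ge> 0\<close> by (intro le_imp_neg_le mult_left_mono) (auto simp: le_divide_eq)
      finally show ?thesis by simp
    qed
    ultimately show "D / (L t)\<^sup>2 * (a t * q'' \<xi> + pi\<^sup>2 * (a t * q \<xi> + b t))
        \<le> \<mu> * a t * q \<xi> + (\<mu> * b t - N * exp (\<mu> * t))"
      by (simp add: algebra_simps)
  qed (use x sol in auto)
  show thesis
  proof (rule that)
    show "a 2 \<ge> 0" using \<open>k \<ge> 0\<close> by (simp add: a_def)
    fix x assume x: "0 \<le> x" "x \<le> L 2"
    have "barrier a b q x 2 \<le> weight x 2 * (a 2 * sin (pi * (x / L 2)))"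
      unfolding barrier_def b_def using q(2)[of "x / L 2"] x L_pos[of 2] weight_pos[of x 2] \<open>a 2 \<ge> 0\<close>
      by (simp add: mult_left_mono)
    then show "\<psi> x 2 \<le> weight x 2 * (a 2 * sin (pi * (x / L 2)))"
      using bound[OF x] by simp
  qed
qed

section \<open>Decay\<close>

text \<open>From time 2 on the weighted principal eigenfunction is itself a barrier.\<close>

lemma solution_bounded_by_weight:
  assumes sol: "linear_moving_solution D r L \<psi>"
  obtains C where "C \<ge> 0" "\<And>x t. t \<ge> 2 \<Longrightarrow> 0 \<le> x \<Longrightarrow> x \<le> L t \<Longrightarrow> \<psi> x t \<le> C * weight x t"
proof -
  obtain C where C: "C \<ge> 0"
    "\<And>x. 0 \<le> x \<Longrightarrow> x \<le> L 2 \<Longrightarrow> \<psi> x 2 \<le> weight x 2 * (C * sin (pi * (x / L 2)))"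
    using dominated_by_eigenfunction[OF sol] by blast
  show thesis
  proof (rule that[OF C(1)])
    fix x t :: real assume t: "t \<ge> 2" and x: "0 \<le> x" "x \<le> L t"
    have "\<psi> x t \<le> barrier (\<lambda>_. C) (\<lambda>_. 0) (\<lambda>\<xi>. sin (pi * \<xi>)) x t"
    proof (rule solution_le_barrier[where ?T0.0 = 2 and ?T1.0 = t and a' = "\<lambda>_. 0" and b' = "\<lambda>_. 0"
          and q' = "\<lambda>\<xi>. pi * cos (pi * \<xi>)" and q'' = "\<lambda>\<xi>. - pi\<^sup>2 * sin (pi * \<xi>)"])
      show "0 \<le> C * sin (pi * \<xi>) + 0" if "0 \<le> \<xi>" "\<xi> \<le> 1" for \<xi>
        using that C(1) by (auto intro!: mult_nonneg_nonneg sin_ge_zero simp: mult_left_le)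
    qed (use t x sol C(2) in \<open>auto intro!: derivative_eq_intros simp: barrier_def power2_eq_square\<close>)
    also have "\<dots> \<le> weight x t * (C * 1)"
      unfolding barrier_def using C(1) weight_pos[of x t]
      by (simp add: mult_left_le)
    finally show "\<psi> x t \<le> C * weight x t"
      by (simp add: mult.commute)
  qed
qed

lemma weight_le:
  assumes bound: "\<And>t. t \<ge> 0 \<Longrightarrow> L1 t * L t \<ge> - K" and "K \<ge> 0"
    and "t \<ge> 0" "0 \<le> x" "x \<le> L t"
  shows "weight x t \<le> exp (K / (4 * D)) * exp (- gain t)"
proof -
  have L: "L t > 0" using L_pos assms by simp
  have "- K \<le> (x / L t)\<^sup>2 * (- K)"
  proof -
    have "(x / L t)\<^sup>2 \<le> 1" using assms L by (simp add: power_le_one)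
    then show ?thesis using mult_right_mono[of "(x / L t)\<^sup>2" 1 K] \<open>K \<ge> 0\<close> by simp
  qed
  also have "\<dots> \<le> (x / L t)\<^sup>2 * (L1 t * L t)"
    using bound[of t] assms by (intro mult_left_mono) auto
  also have "\<dots> = x\<^sup>2 * L1 t / L t"
    using L by (simp add: field_simps power2_eq_square)
  finally have "- K / (4 * D) \<le> x\<^sup>2 * L1 t / L t / (4 * D)"
    using D_pos by (intro divide_right_mono) auto
  then show ?thesis
    unfolding weight_def exp_add[symmetric] by (simp add: mult.commute)
qed

end

theorem corollary3p2:
  fixes D r :: real
    and L L1 L2 :: "real \<Rightarrow> real"
    and \<psi> :: "real \<Rightarrow> real \<Rightarrow> real"
  assumes "D > 0" and "r > 0"
    and "C2_halfline L L1 L2"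
    and "\<And>t. t \<ge> 0 \<Longrightarrow> L t > 0"
    and "linear_moving_solution D r L \<psi>"
    and "\<And>x t. t \<ge> 0 \<Longrightarrow> 0 \<le> x \<Longrightarrow> x \<le> L t \<Longrightarrow> \<psi> x t \<ge> 0"
    and "bdd_below ((\<lambda>t. L1 t * L t) ` {0..})"
    and "filterlim
           (\<lambda>T. integral {0..T}
             (\<lambda>t. D * pi\<^sup>2 / (L t)\<^sup>2 - D * pi\<^sup>2 / (L_crit D r)\<^sup>2
                  - L t * pos_part (L2 t) / (4 * D) + L1 t / (2 * L t)))
           at_top at_top"
  shows "\<forall>\<epsilon>>0. \<forall>\<^sub>F t in at_top. \<forall>x\<in>{0..L t}. \<bar>\<psi> x t\<bar> < \<epsilon>"
proof (intro allI impI)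
  fix \<epsilon> :: real assume "\<epsilon> > 0"
  interpret moving_interval D r L L1 L2
    using assms(1-4) by unfold_locales
  obtain C where C: "C \<ge> 0" "\<And>x t. t \<ge> 2 \<Longrightarrow> 0 \<le> x \<Longrightarrow> x \<le> L t \<Longrightarrow> \<psi> x t \<le> C * weight x t"
    using solution_bounded_by_weight[OF assms(5)] by blast
  obtain m where m: "\<And>t. t \<ge> 0 \<Longrightarrow> m \<le> L1 t * L t"
    using assms(7) by (auto simp: bdd_below_def)
  define K where "K = max (- m) 0"
  have K: "K \<ge> 0" "\<And>t. t \<ge> 0 \<Longrightarrow> - K \<le> L1 t * L t"
    using m by (force simp: K_def)+
  have "filterlim gain at_top at_top"
    using assms(8) unfolding gain_def[abs_def] rate_def[abs_def] .
  then have "((\<lambda>t. exp (- gain t)) \<longlongrightarrow> 0) at_top"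
    by (intro filterlim_compose[OF exp_at_bot]) (simp add: filterlim_uminus_at_top)
  then have "((\<lambda>t. C * exp (K / (4 * D)) * exp (- gain t)) \<longlongrightarrow> 0) at_top"
    by (rule tendsto_mult_right_zero)
  then have "\<forall>\<^sub>F t in at_top. C * exp (K / (4 * D)) * exp (- gain t) < \<epsilon>"
    using \<open>\<epsilon> > 0\<close> by (rule order_tendstoD)
  then show "\<forall>\<^sub>F t in at_top. \<forall>x\<in>{0..L t}. \<bar>\<psi> x t\<bar> < \<epsilon>"
    using eventually_ge_at_top[of 2]
  proof eventually_elim
    case (elim t)
    show ?case
    proof
      fix x assume x: "x \<in> {0..L t}"
      have "\<psi> x t \<le> C * weight x t"
        using C(2)[of t x] elim x by simp
      also have "\<dots> \<le> C * (exp (K / (4 * D)) * exp (- gain t))"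
        using weight_le[OF K(2,1), of t x] elim x C(1) by (intro mult_left_mono) auto
      also have "\<dots> < \<epsilon>" using elim by (simp add: mult.assoc)
      finally show "\<bar>\<psi> x t\<bar> < \<epsilon>"
        using assms(6)[of t x] elim x by simp
    qed
  qed
qed

end
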